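(* Let $\mathcal{S}=\{1,\ldots,S\}$ and assume that $\mathcal{D}_{\mathrm{KL}}(\pi^{(i)}_{k|k-1}||p_{k|k-1})<+\infty$ for all $k$ and all $i\in\mathcal{S}$. Let $\alpha_k^{(i)}\ge 0$, $i\in\mathcal{S}$, be weights with $\sum_{i\in\mathcal{S}}\alpha_k^{(i)}=1$. Then $$\mathcal{D}_{\mathrm{KL}}\left(\sum_{i\in\mathcal{S}}\alpha_k^{(i)}\pi^{(i)}_{k|k-1}\,\Big|\Big|\,p_{k|k-1}\right)\le\sum_{i\in\mathcal{S}}\alpha_k^{(i)}\,\mathcal{D}_{\mathrm{KL}}\left(\pi^{(i)}_{k|k-1}\,||\,p_{k|k-1}\right).$$
   Context: $\mathcal{X}\subseteq\mathbb{R}^d$ (or $\mathcal{X}\subseteq\mathbb{Z}^d$) is the state space and $\mathbf{x}_k\in\mathcal{X}$ is the state at time $k$. For a conditional pdf (pmf in the discrete case, with sums replacing integrals) write $p_{k|k-1}:=p_k(\mathbf{x}_k|\mathbf{x}_{k-1})$, and similarly for $\pi^{(i)}_{k|k-1}$. Here $p_{k|k-1}$ is the given target behavior and $\pi^{(i)}_{k|k-1}$, $i\in\mathcal{S}$, are the given conditional pdfs (pmfs) of the contributors. The Kullback-Leibler divergence of $p^{(1)}$ with respect to $p^{(2)}$, with $p^{(1)}$ absolutely continuous with respect to $p^{(2)}$, is $\mathcal{D}_{\mathrm{KL}}(p^{(1)}||p^{(2)}):=\int p^{(1)}\ln\left(p^{(1)}/p^{(2)}\right)d\mathbf{z}$;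 for conditional pdfs the integral is over $\mathbf{x}_k$ and the divergence is a function of $\mathbf{x}_{k-1}$. The weights $\alpha_k^{(i)}$ do not depend on $\mathbf{x}_k$. All integrals (sums) are assumed to exist. *)

theory Defs
  imports "HOL-Probability.Probability"
begin

text \<open>
  The measure against which densities on the state space \<open>X\<close> are taken: Lebesgue measure on a
  measurable \<open>X\<close> (probability density functions), or counting measure on a set \<open>X\<close> of points with
  integer coordinates (probability mass functions, so that integrals are sums over \<open>X\<close>).
\<close>

definition reference_measure :: "(real ^ 'd) set \<Rightarrow> (real ^ 'd) measure \<Rightarrow> bool" where
  "reference_measure X M \<longleftrightarrow>
     (X \<in> sets lebesgue \<and> M = lebesgue_on X) \<or>
     ((\<forall>x\<in>X. \<forall>j. x $ j \<in> \<int>) \<and> M = count_space X)"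

text \<open>The first argument \<open>y\<close> of \<open>f\<close> is the conditioning variable: \<open>f y x\<close> stands for \<open>f(x | y)\<close>.\<close>

definition conditional_pdf :: "'a measure \<Rightarrow> ('a \<Rightarrow> 'a \<Rightarrow> real) \<Rightarrow> bool" where
  "conditional_pdf M f \<longleftrightarrow>
     (\<forall>y\<in>space M. f y \<in> borel_measurable M \<and> (\<forall>x\<in>space M. 0 \<le> f y x) \<and>
        (\<integral>\<^sup>+x. ennreal (f y x) \<partial>M) = 1)"

text \<open>
  Absolute continuity of the distribution with density \<open>f\<close> with respect to the one with density
  \<open>g\<close>; the library predicate takes the dominating measure first.
\<close>

definition pdf_abs_cont :: "'a measure \<Rightarrow> ('a \<Rightarrow> real) \<Rightarrow> ('a \<Rightarrow> real) \<Rightarrow> bool" where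
  "pdf_abs_cont M f g \<longleftrightarrow>
     absolutely_continuous (density M (\<lambda>z. ennreal (g z))) (density M (\<lambda>z. ennreal (f z)))"

text \<open>
  The integral of \<open>f ln (f / g)\<close> as an extended real, positive part minus negative part, so that
  the value \<open>\<infinity>\<close> is meaningful. For densities the negative part is at most
  \<open>\<integral>g = 1\<close>, because \<open>t ln t \<ge> t - 1\<close>, so the difference is never \<open>\<infinity> - \<infinity>\<close>.
  Where \<open>f z = 0\<close> the integrand is \<open>0\<close>, as usual. It is also \<open>0\<close> where \<open>g z = 0 < f z\<close> (since
  \<open>x / 0 = 0\<close> and \<open>ln 0 = 0\<close>), so the definition is meant for \<open>f\<close> absolutely continuous with
  respect to \<open>g\<close>, when such points form a null set.
\<close>

definition KL_div :: "'a measure \<Rightarrow> ('a \<Rightarrow> real) \<Rightarrow> ('a \<Rightarrow> real) \<Rightarrow> ereal" where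
  "KL_div M f g =
     enn2ereal (\<integral>\<^sup>+z. ennreal (f z * ln (f z / g z)) \<partial>M) -
     enn2ereal (\<integral>\<^sup>+z. ennreal (- (f z * ln (f z / g z))) \<partial>M)"

end

theory Submission
  imports Defs
begin

text \<open>
  The claim is the convexity of \<open>t ln t\<close>, integrated against the target density. Fix the
  conditioning state, and write \<open>f i\<close> for the contributors' densities, \<open>F = \<Sum>i. a i * f i\<close> for
  the mixture and \<open>g\<close> for the target. The tangent to \<open>t \<mapsto> t ln (t / g)\<close> at \<open>u > 0\<close> lies below
  the graph:
  \<open>t ln (u / g) + t - u \<le> t ln (t / g)\<close> (lemma \<open>entropy_tangent\<close>). Taking \<open>u = F\<close>, \<open>t = f i\<close> and
  averaging with the weights, the affine corrections cancel, because \<open>F\<close> is the average of the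
  \<open>f i\<close>. What is left is the pointwise inequality
  \<open>F ln (F / g) \<le> \<Sum>i. a i * (f i * ln (f i / g))\<close> (lemma \<open>mixture_entropy_le\<close>).

  To integrate it, the divergences, which are extended reals, have to be recognised as Lebesgue
  integrals of integrable functions. The tangent at \<open>u = g\<close> gives \<open>t ln (t / g) \<ge> t - g\<close>, so the
  negative part of every integrand is dominated by the integrable \<open>g\<close>. The positive part is
  integrable for each \<open>f i\<close> because its divergence is finite
  (lemma \<open>integrable_KL_integrand\<close>), and hence, by the pointwise inequality, also for the mixture
  (lemma \<open>KL_div_mixture_le\<close>).
\<close>

text \<open>After division by \<open>t\<close>, this is \<open>ln s \<le> s - 1\<close> for \<open>s = u / t\<close>.\<close>

lemma entropy_tangent:
  fixes t u g :: real
  assumes "0 \<le> t" "0 < u" "0 < g"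
  shows "t * ln (u / g) + t - u \<le> t * ln (t / g)"
proof (cases "t = 0")
  case False
  with assms have t: "0 < t" by simp
  have "t * ln (u / t) \<le> t * (u / t - 1)"
    using t assms by (intro mult_left_mono ln_le_minus_one) auto
  also have "\<dots> = u - t"
    using t by (simp add: field_simps)
  finally show ?thesis
    using t assms by (simp add: ln_div algebra_simps)
qed (use assms in simp)

text \<open>
  The tangent at \<open>g\<close> itself. At \<open>g = 0\<close> the left-hand side is \<open>0\<close>, since \<open>t / 0 = 0\<close> and
  \<open>ln 0 = 0\<close>; this is why the bound is \<open>- g\<close> and not the sharper \<open>t - g\<close>.
\<close>

lemma KL_integrand_ge:
  fixes t g :: real
  assumes "0 \<le> t" "0 \<le> g"
  shows "- g \<le> t * ln (t / g)"
  using entropy_tangent[of t g g] assms by (cases "g = 0") auto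

lemma mixture_entropy_le:
  fixes a f :: "'i \<Rightarrow> real" and g :: real
  assumes "finite I" and a: "\<And>i. i \<in> I \<Longrightarrow> 0 \<le> a i" and sum_a: "(\<Sum>i\<in>I. a i) = 1"
    and f: "\<And>i. i \<in> I \<Longrightarrow> 0 \<le> f i" and "0 \<le> g"
  shows "(\<Sum>i\<in>I. a i * f i) * ln ((\<Sum>i\<in>I. a i * f i) / g) \<le> (\<Sum>i\<in>I. a i * (f i * ln (f i / g)))"
    (is "?F * ln (?F / g) \<le> ?R")
proof -
  have "0 \<le> ?F"
    using a f by (intro sum_nonneg) auto
  then consider "g = 0" | "?F = 0" | "0 < g" "0 < ?F"
    using \<open>0 \<le> g\<close> by linarith
  then show ?thesis
  proof cases
    case 1
    then show ?thesis by simp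
  next
    case 2
    then have "\<forall>i\<in>I. a i * f i = 0"
      using \<open>finite I\<close> a f by (subst (asm) sum_nonneg_eq_0_iff) auto
    then have "?R = 0"
      by (intro sum.neutral) auto
    with 2 show ?thesis by simp
  next
    case 3
    have "(\<Sum>i\<in>I. a i * (f i * l + f i - u)) = ?F * l + ?F - (\<Sum>i\<in>I. a i) * u" for l u
      by (simp add: algebra_simps sum.distrib sum_subtractf sum_distrib_left)
    then have "?F * ln (?F / g) = (\<Sum>i\<in>I. a i * (f i * ln (?F / g) + f i - ?F))"
      by (simp add: sum_a)
    also have "\<dots> \<le> ?R"
      using 3 a f by (intro sum_mono mult_left_mono entropy_tangent) auto
    finally show ?thesis .
  qed
qed

lemma KL_div_eq_integral:
  assumes "integrable M (\<lambda>z. f z * ln (f z / g z))"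
  shows "KL_div M f g = ereal (\<integral>z. f z * ln (f z / g z) \<partial>M)"
proof -
  let ?h = "\<lambda>z. f z * ln (f z / g z)"
  have enn2ereal_eq: "enn2ereal c = ereal (enn2real c)" if "c \<noteq> \<infinity>" for c
    using that by (cases c) auto
  have "(\<integral>\<^sup>+z. ennreal (?h z) \<partial>M) \<noteq> \<infinity>" "(\<integral>\<^sup>+z. ennreal (- ?h z) \<partial>M) \<noteq> \<infinity>"
    using assms by (auto simp: real_integrable_def)
  then show ?thesis
    unfolding KL_div_def by (simp add: enn2ereal_eq real_lebesgue_integral_def[OF assms])
qed

text \<open>
  A finite divergence has a finite positive part even before the negative part is known to be
  finite, because \<open>\<infinity> - \<infinity> = \<infinity>\<close> in the extended reals.
\<close>

lemma integrable_KL_integrand: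
  assumes [measurable]: "f \<in> borel_measurable M" and g: "integrable M g"
    and nonneg: "\<And>z. z \<in> space M \<Longrightarrow> 0 \<le> f z" "\<And>z. z \<in> space M \<Longrightarrow> 0 \<le> g z"
    and fin: "KL_div M f g < \<infinity>"
  shows "integrable M (\<lambda>z. f z * ln (f z / g z))"
proof -
  let ?h = "\<lambda>z. f z * ln (f z / g z)"
  have [measurable]: "g \<in> borel_measurable M"
    using g by (rule borel_measurable_integrable)
  have "(\<integral>\<^sup>+z. ennreal (- ?h z) \<partial>M) \<le> (\<integral>\<^sup>+z. ennreal (g z) \<partial>M)"
    using KL_integrand_ge[OF nonneg]
    by (intro nn_integral_mono ennreal_leI) (auto simp: minus_le_iff)
  also have "\<dots> < \<infinity>"
    using g by (auto simp: real_integrable_def less_top)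
  finally have neg: "(\<integral>\<^sup>+z. ennreal (- ?h z) \<partial>M) \<noteq> \<infinity>"
    by simp
  have pos: "(\<integral>\<^sup>+z. ennreal (?h z) \<partial>M) \<noteq> \<infinity>"
    using fin unfolding KL_div_def by auto
  show ?thesis
    unfolding real_integrable_def using neg pos by simp
qed

text \<open>
  Convexity of the divergence in its first argument, over an arbitrary reference measure. The
  integrand of the mixture lies between the integrable functions \<open>- g\<close> and the average of the
  integrands of the \<open>f i\<close>.
\<close>

lemma KL_div_mixture_le:
  assumes "finite I" and a: "\<And>i. i \<in> I \<Longrightarrow> 0 \<le> a i" and sum_a: "(\<Sum>i\<in>I. a i) = 1"
    and f: "\<And>i. i \<in> I \<Longrightarrow> f i \<in> borel_measurable M"
    and f_nonneg: "\<And>i z. i \<in> I \<Longrightarrow> z \<in> space M \<Longrightarrow> 0 \<le> f i z"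
    and g: "integrable M g" and g_nonneg: "\<And>z. z \<in> space M \<Longrightarrow> 0 \<le> g z"
    and fin: "\<And>i. i \<in> I \<Longrightarrow> KL_div M (f i) g < \<infinity>"
  shows "KL_div M (\<lambda>z. \<Sum>i\<in>I. a i * f i z) g \<le> (\<Sum>i\<in>I. ereal (a i) * KL_div M (f i) g)"
proof -
  let ?F = "\<lambda>z. \<Sum>i\<in>I. a i * f i z"
  let ?H = "\<lambda>z. ?F z * ln (?F z / g z)"
  let ?h = "\<lambda>i z. f i z * ln (f i z / g z)"
  let ?R = "\<lambda>z. \<Sum>i\<in>I. a i * ?h i z"
  have h: "integrable M (?h i)" if "i \<in> I" for i
    using that f f_nonneg g g_nonneg fin by (intro integrable_KL_integrand) auto
  have R: "integrable M ?R"
    using h by (intro Bochner_Integration.integrable_sum integrable_mult_right) auto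
  have le: "?H z \<le> ?R z" if "z \<in> space M" for z
    using that \<open>finite I\<close> a sum_a f_nonneg g_nonneg by (intro mixture_entropy_le) auto
  have ge: "- g z \<le> ?H z" if "z \<in> space M" for z
    using that a f_nonneg g_nonneg by (intro KL_integrand_ge sum_nonneg) auto
  have [measurable]: "g \<in> borel_measurable M" "?F \<in> borel_measurable M"
    using g f by (auto intro!: borel_measurable_sum borel_measurable_times)
  have H: "integrable M ?H"
  proof (rule Bochner_Integration.integrable_bound)
    show "integrable M (\<lambda>z. g z + \<bar>?R z\<bar>)"
      using g R by (intro Bochner_Integration.integrable_add integrable_abs)
    show "AE z in M. norm (?H z) \<le> norm (g z + \<bar>?R z\<bar>)"
    proof (rule AE_I2)
      fix z assume "z \<in> space M"
      from le[OF this] ge[OF this] g_nonneg[OF this]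
      show "norm (?H z) \<le> norm (g z + \<bar>?R z\<bar>)"
        unfolding real_norm_def by linarith
    qed
  qed measurable
  have "KL_div M ?F g = ereal (\<integral>z. ?H z \<partial>M)"
    using H by (rule KL_div_eq_integral)
  also have "\<dots> \<le> ereal (\<integral>z. ?R z \<partial>M)"
    using H R le by (simp add: integral_mono)
  also have "(\<integral>z. ?R z \<partial>M) = (\<Sum>i\<in>I. a i * (\<integral>z. ?h i z \<partial>M))"
    using h by (subst Bochner_Integration.integral_sum) auto
  also have "ereal \<dots> = (\<Sum>i\<in>I. ereal (a i) * KL_div M (f i) g)"
    unfolding sum_ereal[symmetric] using h by (intro sum.cong) (auto simp: KL_div_eq_integral)
  finally show ?thesis .
qed

lemma integrable_conditional_pdf:
  assumes "conditional_pdf M q" "y \<in> space M"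
  shows "integrable M (q y)"
  using assms unfolding conditional_pdf_def by (intro integrableI_nonneg) auto

theorem lemma3:
  fixes X :: "(real ^ 'd) set" and M :: "(real ^ 'd) measure"
    and S :: nat
    and p :: "nat \<Rightarrow> real ^ 'd \<Rightarrow> real ^ 'd \<Rightarrow> real"
    and \<pi> :: "nat \<Rightarrow> nat \<Rightarrow> real ^ 'd \<Rightarrow> real ^ 'd \<Rightarrow> real"
    and \<alpha> :: "nat \<Rightarrow> nat \<Rightarrow> real ^ 'd \<Rightarrow> real"
  assumes "reference_measure X M"
    and "\<And>k. k \<ge> 1 \<Longrightarrow> conditional_pdf M (p k)"
    and "\<And>k i. k \<ge> 1 \<Longrightarrow> i \<in> {1..S} \<Longrightarrow> conditional_pdf M (\<pi> k i)"
    and "\<And>k i y. k \<ge> 1 \<Longrightarrow> i \<in> {1..S} \<Longrightarrow> y \<in> X \<Longrightarrow> pdf_abs_cont M (\<pi> k i y) (p k y)"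
    and "\<And>k i y. k \<ge> 1 \<Longrightarrow> i \<in> {1..S} \<Longrightarrow> y \<in> X \<Longrightarrow> KL_div M (\<pi> k i y) (p k y) < \<infinity>"
    and "\<And>k i y. k \<ge> 1 \<Longrightarrow> i \<in> {1..S} \<Longrightarrow> y \<in> X \<Longrightarrow> \<alpha> k i y \<ge> 0"
    and "\<And>k y. k \<ge> 1 \<Longrightarrow> y \<in> X \<Longrightarrow> (\<Sum>i\<in>{1..S}. \<alpha> k i y) = 1"
  shows "\<forall>k\<ge>1. \<forall>y\<in>X.
    KL_div M (\<lambda>x. \<Sum>i\<in>{1..S}. \<alpha> k i y * \<pi> k i y x) (p k y)
      \<le> (\<Sum>i\<in>{1..S}. ereal (\<alpha> k i y) * KL_div M (\<pi> k i y) (p k y))"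
proof (intro allI impI ballI)
  fix k :: nat and y
  assume k: "k \<ge> 1" and y: "y \<in> X"
  have "y \<in> space M"
    using \<open>reference_measure X M\<close> y unfolding reference_measure_def by auto
  then have p: "integrable M (p k y)" "\<And>z. z \<in> space M \<Longrightarrow> 0 \<le> p k y z"
    and \<pi>: "\<And>i. i \<in> {1..S} \<Longrightarrow> \<pi> k i y \<in> borel_measurable M"
      "\<And>i z. i \<in> {1..S} \<Longrightarrow> z \<in> space M \<Longrightarrow> 0 \<le> \<pi> k i y z"
    using assms(2,3)[OF k] integrable_conditional_pdf[OF assms(2)[OF k]]
    unfolding conditional_pdf_def by blast+
  show "KL_div M (\<lambda>x. \<Sum>i\<in>{1..S}. \<alpha> k i y * \<pi> k i y x) (p k y)
      \<le> (\<Sum>i\<in>{1..S}. ereal (\<alpha> k i y) * KL_div M (\<pi> k i y) (p k y))"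
    using assms(5-7) k y p \<pi> by (intro KL_div_mixture_le) blast+
qed

end
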